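(* Let $G$ be a structured bilinear SISO system given by $\mathcal{C},\mathcal{K},\mathcal{N},\mathcal{B}$, with subsystem transfer functions $G_k$, and let $\widehat G$, with subsystem transfer functions $\widehat G_k$, be the reduced-order bilinear SISO system constructed by projection with $W,V\in\mathbb{C}^{n\times r}$. Let $\sigma_1,\ldots,\sigma_k\in\mathbb{C}$ and $\varsigma_1,\ldots,\varsigma_\theta\in\mathbb{C}$ be two sets of interpolation points at which the matrix functions $\mathcal{C}(s)$, $\mathcal{K}(s)^{-1}$, $\mathcal{N}(s)$ and $\mathcal{B}(s)$ are defined and $\widehat{\mathcal{K}}(s)$ is full-rank. Let \[ v_1=\mathcal{K}(\sigma_1)^{-1}\mathcal{B}(\sigma_1),\qquad v_j=\mathcal{K}(\sigma_j)^{-1}\mathcal{N}(\sigma_{j-1})v_{j-1},\quad 2\le j\le k, \] \[ w_1=\mathcal{K}(\varsigma_\theta)^{-\mathsf H}\mathcal{C}(\varsigma_\theta)^{\mathsf H},\qquad w_j=\mathcal{K}(\varsigma_{\theta-j+1})^{-\mathsf H}\mathcal{N}(\varsigma_{\theta-j+1})^{\mathsf H}w_{j-1},\quad 2\le j\le \theta, \] and let $V$ and $W$ be such that $\operatorname{span}(V)\supseteq\operatorname{span}([v_1,\ldots,v_k])$ and $\operatorname{span}(W)\supseteq\operatorname{span}([w_1,\ldots,w_\theta])$. Then \[ G_1(\sigma_1)=\widehat G_1(\sigma_1),\quad G_2(\sigma_1,\sigma_2)=\widehat G_2(\sigma_1,\sigma_2),\quad\ldots,\quad G_k(\sigma_1,\ldots,\sigma_k)=\widehat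 G_k(\sigma_1,\ldots,\sigma_k), \] \[ G_1(\varsigma_\theta)=\widehat G_1(\varsigma_\theta),\quad G_2(\varsigma_{\theta-1},\varsigma_\theta)=\widehat G_2(\varsigma_{\theta-1},\varsigma_\theta),\quad\ldots,\quad G_\theta(\varsigma_1,\ldots,\varsigma_\theta)=\widehat G_\theta(\varsigma_1,\ldots,\varsigma_\theta), \] and additionally \[ G_{q+\eta}(\sigma_1,\ldots,\sigma_q,\varsigma_{\theta-\eta+1},\ldots,\varsigma_\theta)=\widehat G_{q+\eta}(\sigma_1,\ldots,\sigma_q,\varsigma_{\theta-\eta+1},\ldots,\varsigma_\theta) \] for all $1\le q\le k$ and $1\le\eta\le\theta$.
   Context: A structured bilinear SISO (single-input single-output) system $G$ is described by matrix-valued functions of a complex variable $\mathcal{C}\colon\mathbb{C}\to\mathbb{C}^{1\times n}$, $\mathcal{K}\colon\mathbb{C}\to\mathbb{C}^{n\times n}$, $\mathcal{N}\colon\mathbb{C}\to\mathbb{C}^{n\times n}$, $\mathcal{B}\colon\mathbb{C}\to\mathbb{C}^{n\times 1}$ (which may fail to be defined, or $\mathcal{K}$ may fail to be invertible, at some points), through its regular subsystem transfer functions \[ G_k(s_1,\ldots,s_k)=\mathcal{C}(s_k)\mathcal{K}(s_k)^{-1}\Big(\prod_{j=1}^{k-1}\mathcal{N}(s_{k-j})\mathcal{K}(s_{k-j})^{-1}\Big)\mathcal{B}(s_1),\qquad k\ge 1 . \] Products $\prod_{j=1}^{m}A_j$ of matrices are ordered $A_1A_2\cdots A_m$; empty products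 are identities. Given model reduction bases (truncation matrices) $W,V\in\mathbb{C}^{n\times r}$, the reduced-order system $\widehat G$ is given by \[ \widehat{\mathcal{C}}(s)=\mathcal{C}(s)V,\quad \widehat{\mathcal{K}}(s)=W^{\mathsf H}\mathcal{K}(s)V,\quad \widehat{\mathcal{B}}(s)=W^{\mathsf H}\mathcal{B}(s),\quad \widehat{\mathcal{N}}(s)=W^{\mathsf H}\mathcal{N}(s)V, \] and its transfer functions $\widehat G_k$ are defined by the same formula with hatted quantities. Here $^{\mathsf H}$ is the conjugate transpose, $^{-\mathsf H}$ the conjugate transpose of the inverse, and $\operatorname{span}$ of a matrix is its column space. *)

theory Defs
  imports "HOL-Analysis.Analysis"
begin

text \<open>
  The coefficients are partial functions of the complex frequency; the domain of each map is the
  set of points at which it is defined. Row and column vectors are \<open>1 \<times> n\<close> and \<open>n \<times> 1\<close> matrices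
  (\<open>'a^'n^'m\<close> has rows indexed by \<open>'m\<close> and columns indexed by \<open>'n\<close>).
\<close>

record ('n::finite) bilinear_system =
  Cmat :: "complex \<rightharpoonup> complex^'n^1"
  Kmat :: "complex \<rightharpoonup> complex^'n^'n"
  Nmat :: "complex \<rightharpoonup> complex^'n^'n"
  Bmat :: "complex \<rightharpoonup> complex^1^'n"

text \<open>
  Values of the coefficients; these are meaningful only at points of the respective domain.
\<close>

abbreviation Cval :: "('n::finite) bilinear_system \<Rightarrow> complex \<Rightarrow> complex^'n^1"
  where "Cval G s \<equiv> the (Cmat G s)"

abbreviation Kval :: "('n::finite) bilinear_system \<Rightarrow> complex \<Rightarrow> complex^'n^'n"
  where "Kval G s \<equiv> the (Kmat G s)"

abbreviation Nval :: "('n::finite) bilinear_system \<Rightarrow> complex \<Rightarrow> complex^'n^'n"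
  where "Nval G s \<equiv> the (Nmat G s)"

abbreviation Bval :: "('n::finite) bilinear_system \<Rightarrow> complex \<Rightarrow> complex^1^'n"
  where "Bval G s \<equiv> the (Bmat G s)"

definition conj_transpose :: "complex^'n^'m \<Rightarrow> complex^'m^'n"
  where "conj_transpose A = map_matrix cnj (transpose A)"

text \<open>The ordered product \<open>A 1 ** A 2 ** \<dots> ** A m\<close>.\<close>

primrec matrix_prod :: "(nat \<Rightarrow> complex^'n^'n) \<Rightarrow> nat \<Rightarrow> complex^'n^'n"
  where
    "matrix_prod A 0 = mat 1"
  | "matrix_prod A (Suc m) = matrix_prod A m ** A (Suc m)"

text \<open>
  The \<open>k\<close>-th regular subsystem transfer function, for \<open>k \<ge> 1\<close>, at \<open>(s 1, \<dots>, s k)\<close>;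
  its value is a \<open>1 \<times> 1\<close> matrix.
\<close>

definition transfer_function ::
    "('n::finite) bilinear_system \<Rightarrow> nat \<Rightarrow> (nat \<Rightarrow> complex) \<Rightarrow> complex^1^1"
  where
    "transfer_function G k s =
       Cval G (s k) ** matrix_inv (Kval G (s k)) **
       matrix_prod (\<lambda>j. Nval G (s (k - j)) ** matrix_inv (Kval G (s (k - j)))) (k - 1) **
       Bval G (s 1)"

definition reduced_system ::
    "complex^'r^'n \<Rightarrow> complex^'r^'n \<Rightarrow> ('n::finite) bilinear_system \<Rightarrow> ('r::finite) bilinear_system"
  where
    "reduced_system W V G =
       \<lparr> Cmat = (\<lambda>s. map_option (\<lambda>A. A ** V) (Cmat G s)),
         Kmat = (\<lambda>s. map_option (\<lambda>A. conj_transpose W ** A ** V) (Kmat G s)),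
         Nmat = (\<lambda>s. map_option (\<lambda>A. conj_transpose W ** A ** V) (Nmat G s)),
         Bmat = (\<lambda>s. map_option (\<lambda>A. conj_transpose W ** A) (Bmat G s)) \<rparr>"

definition interpolation_point ::
    "('n::finite) bilinear_system \<Rightarrow> complex^'r^'n \<Rightarrow> complex^'r^'n \<Rightarrow> complex \<Rightarrow> bool"
  where
    "interpolation_point G W V s \<longleftrightarrow>
       s \<in> dom (Cmat G) \<and> s \<in> dom (Kmat G) \<and> invertible (Kval G s) \<and>
       s \<in> dom (Nmat G) \<and> s \<in> dom (Bmat G) \<and>
       rank (Kval (reduced_system W V G) s) = CARD('r)"

text \<open>
  The span has to be taken over the complex numbers: \<open>vec.span\<close> uses the scalars of the vector
  entries, whereas plain \<open>span\<close> would be the real span.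
\<close>

definition column_space :: "complex^'m^'n \<Rightarrow> (complex^'n) set"
  where "column_space A = vec.span (columns A)"

end

theory Submission
  imports Defs
begin

text \<open>
  Writing \<open>x\<^sub>j\<close> for the vectors generated from the input side and \<open>y\<^sub>j\<close> for the row vectors generated
  from the output side, every transfer function splits as \<open>y N x\<close> at any position of its argument
  list, and as \<open>C x\<close> and \<open>y B\<close> at the two ends. If \<open>x\<^sub>j = V z\<close>, then multiplying the recurrence
  \<open>K x\<^sub>j = N x\<^sub>j\<^sub>-\<^sub>1\<close> by \<open>W\<^sup>H\<close> shows that \<open>z\<close> satisfies the recurrence of the reduced system, so \<open>z\<close> is
  the reduced input vector; dually each \<open>y\<^sub>j\<close> is the reduced output vector times \<open>W\<^sup>H\<close>. Inserting
  both into the three splittings turns the coefficients of \<open>G\<close> into the reduced ones.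
\<close>

section \<open>Conjugate transposes, inverses and column spaces\<close>

lemma conj_transpose_mult: "conj_transpose (A ** B) = conj_transpose B ** conj_transpose A"
  by (simp add: conj_transpose_def map_matrix_def transpose_def matrix_matrix_mult_def
      vec_eq_iff mult.commute)

lemma conj_transpose_conj_transpose [simp]: "conj_transpose (conj_transpose A) = A"
  by (simp add: conj_transpose_def map_matrix_def transpose_def vec_eq_iff)

lemma matrix_inv_mult_cancel:
  fixes A :: "'a::semiring_1^'n^'n"
  assumes "invertible A"
  shows "matrix_inv A ** A = mat 1" "A ** matrix_inv A = mat 1"
proof -
  have "\<exists>B. A ** B = mat 1 \<and> B ** A = mat 1"
    using assms by (simp add: invertible_def)
  then have "A ** matrix_inv A = mat 1 \<and> matrix_inv A ** A = mat 1"
    unfolding matrix_inv_def by (rule someI_ex)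
  then show "matrix_inv A ** A = mat 1" "A ** matrix_inv A = mat 1"
    by auto
qed

text \<open>Full row rank makes the rows span the whole space, which yields a left inverse, and for
  a square matrix that is enough. This turns the rank condition of
  \<open>interpolation_point\<close> into invertibility of the reduced \<open>Kmat\<close>.\<close>

lemma full_rank_invertible:
  fixes A :: "'a::field^'n^'n"
  assumes "rank A = CARD('n)"
  shows "invertible A"
proof -
  have "vec.span (rows A) = UNIV"
    using assms
    by (simp add: row_rank_def_gen card_cart_basis vec.dimension_def flip: vec.dim_eq_full)
  then show ?thesis
    by (simp add: invertible_left_inverse matrix_left_invertible_span_rows_gen)
qed

lemma column_spaceE:
  assumes "x \<in> column_space V"
  obtains z where "x = V *v z"
proof -
  have "columns V \<subseteq> range ((*v) V)"
  proof
    fix c assume "c \<in> columns V"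
    then obtain i where "c = column i V"
      by (auto simp: columns_def)
    then have "c = V *v axis i 1"
      by (simp add: vec_eq_iff column_def matrix_vector_mult_def axis_def if_distrib cong: if_cong)
    then show "c \<in> range ((*v) V)"
      by blast
  qed
  moreover have "vec.subspace (range ((*v) V))"
    using vec.linear_subspace_image[OF matrix_vector_mul_linear_gen vec.subspace_UNIV] .
  ultimately have "column_space V \<subseteq> range ((*v) V)"
    unfolding column_space_def by (rule vec.span_minimal)
  with assms that show thesis
    by blast
qed

lemma columns_subset_column_spaceE:
  assumes "columns A \<subseteq> column_space V"
  obtains Z where "A = V ** Z"
proof -
  have "\<exists>z. column j A = V *v z" for j
  proof -
    have "column j A \<in> column_space V"
      using assms by (auto simp: columns_def)
    then show ?thesis
      by (blast elim: column_spaceE)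
  qed
  then obtain z where z: "\<And>j. column j A = V *v z j"
    by metis
  have "A = V ** (\<chi> i j. z j $ i)"
  proof (simp add: vec_eq_iff, intro allI)
    fix i j
    show "A $ i $ j = (V ** (\<chi> i j. z j $ i)) $ i $ j"
      using arg_cong[OF z[of j], of "\<lambda>x. x $ i"]
      by (simp add: column_def matrix_vector_mult_def matrix_matrix_mult_def)
  qed
  then show thesis
    by (rule that)
qed

section \<open>Projection with the two bases\<close>

lemma reduced_system_val:
  assumes "interpolation_point G W V s"
  shows "Cval (reduced_system W V G) s = Cval G s ** V"
    and "Kval (reduced_system W V G) s = conj_transpose W ** Kval G s ** V"
    and "Nval (reduced_system W V G) s = conj_transpose W ** Nval G s ** V"
    and "Bval (reduced_system W V G) s = conj_transpose W ** Bval G s"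
  using assms by (auto simp: interpolation_point_def reduced_system_def)

lemma invertible_Kval:
  assumes "interpolation_point G W V s"
  shows "invertible (Kval G s)" "invertible (Kval (reduced_system W V G) s)"
  using assms by (auto simp: interpolation_point_def intro: full_rank_invertible)

text \<open>Petrov-Galerkin projection is exact when the solution lies in the trial space: if
  \<open>K ** x = b\<close> and \<open>x = V ** Z\<close>, then multiplying by
  \<open>conj_transpose W\<close> shows that \<open>Z\<close> solves the projected equation, whose
  solution is unique.\<close>

lemma projected_solve_left:
  fixes V W :: "complex^'r^'n"
  assumes "invertible K" "invertible (conj_transpose W ** K ** V)"
    and "columns (matrix_inv K ** b) \<subseteq> column_space V"
  shows "matrix_inv K ** b
    = V ** (matrix_inv (conj_transpose W ** K ** V) ** (conj_transpose W ** b))"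
proof -
  obtain Z where Z: "matrix_inv K ** b = V ** Z"
    using assms(3) by (rule columns_subset_column_spaceE)
  have "b = K ** (matrix_inv K ** b)"
    by (simp add: matrix_mul_assoc matrix_inv_mult_cancel[OF assms(1)])
  then have "conj_transpose W ** b = (conj_transpose W ** K ** V) ** Z"
    by (metis Z matrix_mul_assoc)
  then have "matrix_inv (conj_transpose W ** K ** V) ** (conj_transpose W ** b) = Z"
    by (metis matrix_mul_assoc matrix_mul_lid matrix_inv_mult_cancel(1)[OF assms(2)])
  with Z show ?thesis
    by simp
qed

text \<open>The dual argument: a row solution of \<open>y ** K = c\<close> of the form
  \<open>conj_transpose Z ** conj_transpose W\<close> is multiplied by \<open>V\<close> from the
  right.\<close>

lemma projected_solve_right:
  fixes V W :: "complex^'r^'n"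
  assumes "invertible K" "invertible (conj_transpose W ** K ** V)"
    and "columns (conj_transpose (c ** matrix_inv K)) \<subseteq> column_space W"
  shows "c ** matrix_inv K
    = (c ** V ** matrix_inv (conj_transpose W ** K ** V)) ** conj_transpose W"
proof -
  obtain Z where "conj_transpose (c ** matrix_inv K) = W ** Z"
    using assms(3) by (rule columns_subset_column_spaceE)
  then have Z: "c ** matrix_inv K = conj_transpose Z ** conj_transpose W"
    by (metis conj_transpose_conj_transpose conj_transpose_mult)
  have "c = (c ** matrix_inv K) ** K"
    by (simp add: matrix_inv_mult_cancel[OF assms(1)] flip: matrix_mul_assoc)
  then have "c ** V = conj_transpose Z ** (conj_transpose W ** K ** V)"
    by (metis Z matrix_mul_assoc)
  then have "c ** V ** matrix_inv (conj_transpose W ** K ** V) = conj_transpose Z"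
    by (metis matrix_mul_assoc matrix_mul_rid matrix_inv_mult_cancel(2)[OF assms(2)])
  with Z show ?thesis
    by simp
qed

section \<open>Input and output vectors of the full and the reduced system\<close>

text \<open>
  Index shift: \<open>input_state G \<sigma> m\<close> is \<open>v\<^sub>m\<^sub>+\<^sub>1\<close> and \<open>output_state G t m\<close> is the conjugate transpose of
  \<open>w\<^sub>m\<^sub>+\<^sub>1\<close>, where \<open>t\<close> lists the output points backwards: \<open>t 0\<close> is the last one.
\<close>

primrec input_state ::
    "('n::finite) bilinear_system \<Rightarrow> (nat \<Rightarrow> complex) \<Rightarrow> nat \<Rightarrow> complex^1^'n"
  where
    "input_state G s 0 = matrix_inv (Kval G (s 1)) ** Bval G (s 1)"
  | "input_state G s (Suc m) =
       matrix_inv (Kval G (s (Suc (Suc m)))) ** (Nval G (s (Suc m)) ** input_state G s m)"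

primrec output_state ::
    "('n::finite) bilinear_system \<Rightarrow> (nat \<Rightarrow> complex) \<Rightarrow> nat \<Rightarrow> complex^'n^1"
  where
    "output_state G t 0 = Cval G (t 0) ** matrix_inv (Kval G (t 0))"
  | "output_state G t (Suc m) =
       output_state G t m ** Nval G (t (Suc m)) ** matrix_inv (Kval G (t (Suc m)))"

lemma input_state_cong:
  assumes "\<And>i. 1 \<le> i \<Longrightarrow> i \<le> Suc m \<Longrightarrow> s i = s' i"
  shows "input_state G s m = input_state G s' m"
  using assms by (induction m) simp_all

lemma output_state_cong:
  assumes "\<And>i. i \<le> m \<Longrightarrow> t i = t' i"
  shows "output_state G t m = output_state G t' m"
  using assms by (induction m) simp_all

lemma input_state_reduced:
  assumes "\<And>i. i \<le> m \<Longrightarrow> interpolation_point G W V (s (Suc i))"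
    and "\<And>i. i \<le> m \<Longrightarrow> columns (input_state G s i) \<subseteq> column_space V"
  shows "input_state G s m = V ** input_state (reduced_system W V G) s m"
  using assms
proof (induction m)
  case 0
  have p: "interpolation_point G W V (s (Suc 0))"
    using 0(1)[of 0] by simp
  show ?case
    using projected_solve_left[of "Kval G (s (Suc 0))" W V "Bval G (s (Suc 0))"] 0(2)[of 0] invertible_Kval[OF p]
    by (simp add: reduced_system_val[OF p])
next
  case (Suc m)
  have p: "interpolation_point G W V (s (Suc (Suc m)))" and p': "interpolation_point G W V (s (Suc m))"
    using Suc.prems(1)[of "Suc m"] Suc.prems(1)[of m] by simp_all
  have IH: "input_state G s m = V ** input_state (reduced_system W V G) s m"
    using Suc by simp
  have "input_state G s (Suc m) = V ** (matrix_inv (conj_transpose W ** Kval G (s (Suc (Suc m))) ** V)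
      ** (conj_transpose W ** (Nval G (s (Suc m)) ** input_state G s m)))"
    using projected_solve_left[of "Kval G (s (Suc (Suc m)))" W V] Suc.prems(2)[of "Suc m"]
      invertible_Kval[OF p]
    by (simp add: reduced_system_val[OF p])
  \<comment> \<open>The factor \<open>V\<close> supplied by the induction hypothesis turns
    \<open>conj_transpose W ** Nval G s\<close> into the reduced coefficient.\<close>
  also have "\<dots> = V ** input_state (reduced_system W V G) s (Suc m)"
    by (simp add: reduced_system_val[OF p] reduced_system_val[OF p'] IH matrix_mul_assoc)
  finally show ?case .
qed

lemma output_state_reduced:
  assumes "\<And>i. i \<le> m \<Longrightarrow> interpolation_point G W V (t i)"
    and "\<And>i. i \<le> m \<Longrightarrow> columns (conj_transpose (output_state G t i)) \<subseteq> column_space W"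
  shows "output_state G t m = output_state (reduced_system W V G) t m ** conj_transpose W"
  using assms
proof (induction m)
  case 0
  have p: "interpolation_point G W V (t 0)"
    using 0(1)[of 0] by simp
  show ?case
    using projected_solve_right[of "Kval G (t 0)" W V "Cval G (t 0)"] 0(2)[of 0] invertible_Kval[OF p]
    by (simp add: reduced_system_val[OF p])
next
  case (Suc m)
  have p: "interpolation_point G W V (t (Suc m))"
    using Suc.prems(1)[of "Suc m"] by simp
  have IH: "output_state G t m = output_state (reduced_system W V G) t m ** conj_transpose W"
    using Suc by simp
  have "output_state G t (Suc m) = (output_state G t m ** Nval G (t (Suc m)) ** V
      ** matrix_inv (conj_transpose W ** Kval G (t (Suc m)) ** V)) ** conj_transpose W"
    using projected_solve_right[of "Kval G (t (Suc m))" W V] Suc.prems(2)[of "Suc m"]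
      invertible_Kval[OF p]
    by (simp add: reduced_system_val[OF p])
  also have "\<dots> = output_state (reduced_system W V G) t (Suc m) ** conj_transpose W"
    by (simp add: reduced_system_val[OF p] IH matrix_mul_assoc)
  finally show ?case .
qed

section \<open>Splittings of the transfer functions\<close>

lemma output_state_eq_matrix_prod:
  "output_state G t m = Cval G (t 0) ** matrix_inv (Kval G (t 0)) **
     matrix_prod (\<lambda>j. Nval G (t j) ** matrix_inv (Kval G (t j))) m"
  by (induction m) (simp_all add: matrix_mul_assoc)

lemma transfer_function_output:
  "transfer_function G (Suc m) s = output_state G (\<lambda>j. s (Suc m - j)) m ** Bval G (s 1)"
  by (simp add: transfer_function_def output_state_eq_matrix_prod)

text \<open>Induction moves the cut towards the output: the last factors N and K^-1 of the output
  vector are peeled off, K^-1 completes the next input vector and N becomes the new middle factor.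
  As the output vector gets shorter, \<open>b\<close> has to be arbitrary.\<close>

lemma transfer_function_split:
  "transfer_function G (Suc (Suc (a + b))) s =
     output_state G (\<lambda>j. s (Suc (Suc (a + b)) - j)) b ** Nval G (s (Suc a)) ** input_state G s a"
proof (induction a arbitrary: b)
  case 0
  then show ?case
    by (simp add: transfer_function_output matrix_mul_assoc)
next
  case (Suc a)
  have "Suc (Suc (a + Suc b)) = Suc (Suc (Suc a + b))"
    by simp
  with Suc[of "Suc b"] show ?case
    by (simp add: matrix_mul_assoc)
qed

lemma transfer_function_input:
  "transfer_function G (Suc m) s = Cval G (s (Suc m)) ** input_state G s m"
proof (cases m)
  case 0
  then show ?thesis
    by (simp add: transfer_function_output matrix_mul_assoc)
next
  case (Suc a)
  then show ?thesis
    \<comment> \<open>For \<open>b = 0\<close> the output vector is just C K^-1 at the last point,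
      and its K^-1 completes the last input vector.\<close>
    using transfer_function_split[of G a 0 s] by (simp add: matrix_mul_assoc)
qed

section \<open>The interpolation conditions\<close>

theorem theorem3:
  fixes G :: "('n::finite) bilinear_system"
    and W V :: "complex^('r::finite)^'n"
    and k \<theta> :: nat
    and \<sigma> \<tau> :: "nat \<Rightarrow> complex"
    and v w :: "nat \<Rightarrow> complex^1^'n"
  assumes "1 \<le> k" and "1 \<le> \<theta>"
    and "\<forall>j\<in>{1..k}. interpolation_point G W V (\<sigma> j)"
    and "\<forall>j\<in>{1..\<theta>}. interpolation_point G W V (\<tau> j)"
    and "v 1 = matrix_inv (Kval G (\<sigma> 1)) ** Bval G (\<sigma> 1)"
    and "\<forall>j\<in>{2..k}. v j = matrix_inv (Kval G (\<sigma> j)) ** Nval G (\<sigma> (j - 1)) ** v (j - 1)"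
    and "w 1 = conj_transpose (matrix_inv (Kval G (\<tau> \<theta>))) ** conj_transpose (Cval G (\<tau> \<theta>))"
    and "\<forall>j\<in>{2..\<theta>}. w j = conj_transpose (matrix_inv (Kval G (\<tau> (\<theta> - j + 1)))) **
                          conj_transpose (Nval G (\<tau> (\<theta> - j + 1))) ** w (j - 1)"
    and "vec.span (\<Union>j\<in>{1..k}. columns (v j)) \<subseteq> column_space V"
    and "vec.span (\<Union>j\<in>{1..\<theta>}. columns (w j)) \<subseteq> column_space W"
  shows "(\<forall>j\<in>{1..k}.
            transfer_function G j \<sigma> = transfer_function (reduced_system W V G) j \<sigma>) \<and>
         (\<forall>j\<in>{1..\<theta>}.
            transfer_function G j (\<lambda>i. \<tau> (\<theta> - j + i)) =
            transfer_function (reduced_system W V G) j (\<lambda>i. \<tau> (\<theta> - j + i))) \<and>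
         (\<forall>q\<in>{1..k}. \<forall>\<eta>\<in>{1..\<theta>}.
            transfer_function G (q + \<eta>)
              (\<lambda>i. if i \<le> q then \<sigma> i else \<tau> (\<theta> - \<eta> + (i - q))) =
            transfer_function (reduced_system W V G) (q + \<eta>)
              (\<lambda>i. if i \<le> q then \<sigma> i else \<tau> (\<theta> - \<eta> + (i - q))))"
proof -
  let ?H = "reduced_system W V G"
  let ?t = "\<lambda>i. \<tau> (\<theta> - i)"
  have v: "v (Suc i) = input_state G \<sigma> i" if "i < k" for i
    using that
  proof (induction i)
    case 0
    then show ?case
      using assms(5) by simp
  next
    case (Suc i)
    then show ?case
      using assms(6)[rule_format, of "Suc (Suc i)"] by (simp add: matrix_mul_assoc)
  qed
  have w: "conj_transpose (w (Suc i)) = output_state G ?t i" if "i < \<theta>" for i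
    using that
  proof (induction i)
    case 0
    then show ?case
      using assms(7) by (simp add: conj_transpose_mult)
  next
    case (Suc i)
    \<comment> \<open>Subtraction is truncated, so this needs
      \<open>Suc i < \<theta>\<close>.\<close>
    have "\<theta> - Suc (Suc i) + 1 = \<theta> - Suc i"
      using Suc.prems by simp
    with Suc show ?case
      using assms(8)[rule_format, of "Suc (Suc i)"] by (simp add: conj_transpose_mult matrix_mul_assoc)
  qed
  have x: "input_state G \<sigma> m = V ** input_state ?H \<sigma> m" if "m < k" for m
  proof (rule input_state_reduced)
    fix i assume "i \<le> m"
    with that have i: "Suc i \<in> {1..k}" "i < k"
      by auto
    show "interpolation_point G W V (\<sigma> (Suc i))"
      using assms(3) i by blast
    have "columns (v (Suc i)) \<subseteq> column_space V"
      using i by (intro subset_trans[OF _ assms(9)] subset_trans[OF _ vec.span_superset]) blast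
    then show "columns (input_state G \<sigma> i) \<subseteq> column_space V"
      using v i by simp
  qed
  have y: "output_state G ?t m = output_state ?H ?t m ** conj_transpose W" if "m < \<theta>" for m
  proof (rule output_state_reduced)
    fix i assume "i \<le> m"
    with that have i: "Suc i \<in> {1..\<theta>}" "\<theta> - i \<in> {1..\<theta>}" "i < \<theta>"
      by auto
    show "interpolation_point G W V (?t i)"
      using assms(4) i by blast
    have "columns (w (Suc i)) \<subseteq> column_space W"
      using i by (intro subset_trans[OF _ assms(10)] subset_trans[OF _ vec.span_superset]) blast
    then show "columns (conj_transpose (output_state G ?t i)) \<subseteq> column_space W"
      using i by (simp flip: w)
  qed
  have "transfer_function G j \<sigma> = transfer_function ?H j \<sigma>" if j: "j \<in> {1..k}" for j
  proof -
    obtain m where m: "j = Suc m" "m < k"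
      using j by (cases j) auto
    have p: "interpolation_point G W V (\<sigma> (Suc m))"
      using assms(3) m j by blast
    show ?thesis
      by (simp add: m(1) transfer_function_input reduced_system_val[OF p] x[OF m(2)] matrix_mul_assoc)
  qed
  moreover have "transfer_function G j (\<lambda>i. \<tau> (\<theta> - j + i)) = transfer_function ?H j (\<lambda>i. \<tau> (\<theta> - j + i))"
    if j: "j \<in> {1..\<theta>}" for j
  proof -
    obtain m where m: "j = Suc m" "m < \<theta>"
      using j by (cases j) auto
    have p: "interpolation_point G W V (\<tau> (\<theta> - m))"
      using assms(4) m by simp
    have s1: "\<theta> - Suc m + 1 = \<theta> - m"
      using m by simp
    \<comment> \<open>Reading the shifted argument list backwards gives \<open>?t\<close> on the
      indices up to \<open>m\<close>. The dimension of \<open>F\<close> is left free so that the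
      fact applies to \<open>G\<close> and to \<open>?H\<close>.\<close>
    have outp: "output_state F (\<lambda>i. \<tau> (\<theta> - Suc m + (Suc m - i))) m = output_state F ?t m"
      for F :: "('b::finite) bilinear_system"
      using m by (intro output_state_cong arg_cong[of _ _ \<tau>]) linarith
    show ?thesis
      unfolding m(1) transfer_function_output s1 outp
      by (simp add: reduced_system_val[OF p] y[OF m(2)] matrix_mul_assoc)
  qed
  moreover have "transfer_function G (q + \<eta>) (\<lambda>i. if i \<le> q then \<sigma> i else \<tau> (\<theta> - \<eta> + (i - q))) =
      transfer_function ?H (q + \<eta>) (\<lambda>i. if i \<le> q then \<sigma> i else \<tau> (\<theta> - \<eta> + (i - q)))"
    if q: "q \<in> {1..k}" and \<eta>: "\<eta> \<in> {1..\<theta>}" for q \<eta>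
  proof -
    let ?s = "\<lambda>i. if i \<le> q then \<sigma> i else \<tau> (\<theta> - \<eta> + (i - q))"
    obtain a b where ab: "q = Suc a" "\<eta> = Suc b" "a < k" "b < \<theta>"
      using q \<eta> by (cases q; cases \<eta>) auto
    have sum: "q + \<eta> = Suc (Suc (a + b))"
      using ab by simp
    have p: "interpolation_point G W V (\<sigma> (Suc a))"
      using assms(3) ab q by blast
    have sq: "?s (Suc a) = \<sigma> (Suc a)"
      using ab by simp
    \<comment> \<open>The input vector reads only the first \<open>q\<close> arguments, which all
      come from \<sigma>.\<close>
    have inp: "input_state F ?s a = input_state F \<sigma> a" for F :: "('b::finite) bilinear_system"
      using ab by (intro input_state_cong) simp
    have outp: "output_state F (\<lambda>j. ?s (Suc (Suc (a + b)) - j)) b = output_state F ?t b"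
      for F :: "('b::finite) bilinear_system"
    proof (rule output_state_cong)
      fix i assume "i \<le> b"
      \<comment> \<open>The output vector reads only the last \<open>\<eta>\<close> arguments, so
        the \<tau> branch applies, and no subtraction truncates because
        \<open>i \<le> b < \<theta>\<close>.\<close>
      then have "\<not> Suc (Suc (a + b)) - i \<le> q" "\<theta> - \<eta> + (Suc (Suc (a + b)) - i - q) = \<theta> - i"
        using ab by auto
      then show "?s (Suc (Suc (a + b)) - i) = \<tau> (\<theta> - i)"
        by simp
    qed
    show ?thesis
      \<comment> \<open>With both vectors replaced, the middle factor becomes
        \<open>conj_transpose W ** Nval G (\<sigma> q) ** V\<close>, the reduced coefficient at the
        cut.\<close>
      unfolding sum transfer_function_split inp outp sq reduced_system_val[OF p]
      by (simp add: x[OF ab(3)] y[OF ab(4)] matrix_mul_assoc)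
  qed
  ultimately show ?thesis
    by blast
qed

end
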